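(* There is a function $\varepsilon:\mathbb{N}\to\mathbb{R}$ with $\varepsilon(n)\to 0$ as $n\to\infty$ such that for every $n$ and every 2-CNF formula $\varphi$ on $n$ variables there is a 2-CNF formula $\varphi'$ with $\varphi \Rightarrow^{*}_{\mathrm{BVA}} \varphi'$ and $|\varphi'| \le (1+\varepsilon(n))\frac{n^2}{\lg n}$.
   Context: A literal is a variable $x$ or its negation $\overline{x}$. A clause is a set of non-complementary literals, a formula is a set of clauses, and $|\varphi|$ is the number of clauses of $\varphi$; $\textsf{Var}(\varphi)$ is the set of variables occurring in $\varphi$. A formula is 2-CNF if every clause has exactly two literals. $\lg$ is the base-2 logarithm. BVA step: let $\varphi$ be a formula, let $\mathcal{C},\mathcal{D}$ be sets of nonempty clauses such that $\mathcal{C}\bowtie\mathcal{D} := \{C\cup D : C\in\mathcal{C}, D\in\mathcal{D}\}\subseteq\varphi$, and let $y\notin\textsf{Var}(\varphi)$ be a fresh variable. Then $\varphi' := (\varphi\setminus(\mathcal{C}\bowtie\mathcal{D}))\cup\{C\cup\{y\} : C\in\mathcal{C}\}\cup\{\{\overline{y}\}\cup D : D\in\mathcal{D}\}$ is said to be derived from $\varphi$ in one BVA step, written $\varphi\Rightarrow_{\mathrm{BVA}}\varphi'$. The relation $\Rightarrow^{*}_{\mathrm{BVA}}$ ("idealized BVA") is the reflexive transitive closure of $\Rightarrow_{\mathrm{BVA}}$. *)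

theory Defs
  imports Complex_Main "HOL-Library.Infinite_Typeclass"
begin

datatype 'v lit = Pos 'v | Neg 'v

fun lit_var :: "'v lit \<Rightarrow> 'v" where
  "lit_var (Pos x) = x"
| "lit_var (Neg x) = x"

type_synonym 'v clause = "'v lit set"
type_synonym 'v formula = "'v clause set"

definition is_clause :: "'v clause \<Rightarrow> bool" where
  "is_clause C \<longleftrightarrow> finite C \<and> (\<forall>x. \<not> (Pos x \<in> C \<and> Neg x \<in> C))"

definition is_formula :: "'v formula \<Rightarrow> bool" where
  "is_formula \<phi> \<longleftrightarrow> finite \<phi> \<and> (\<forall>C\<in>\<phi>. is_clause C)"

definition Var :: "'v formula \<Rightarrow> 'v set" where
  "Var \<phi> = (\<Union>C\<in>\<phi>. lit_var ` C)"

definition two_cnf :: "'v formula \<Rightarrow> bool" where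
  "two_cnf \<phi> \<longleftrightarrow> is_formula \<phi> \<and> (\<forall>C\<in>\<phi>. card C = 2)"

definition clause_join :: "'v clause set \<Rightarrow> 'v clause set \<Rightarrow> 'v clause set" (infixl "\<bowtie>" 70) where
  "\<C> \<bowtie> \<D> = {C \<union> D | C D. C \<in> \<C> \<and> D \<in> \<D>}"

(* The sets \<C> and \<D> may be empty, and \<C> \<bowtie> \<D> is empty as soon as one of them is; the
   other one is then unconstrained by \<phi>.  The premise is_formula \<phi>' only matters in
   that case: it excludes an infinite result (whose card would be 0) and a
   tautological clause containing both y and its negation. *)
definition BVA_step :: "'v formula \<Rightarrow> 'v formula \<Rightarrow> bool" (infix "\<Rightarrow>\<^sub>B\<^sub>V\<^sub>A" 50) where
  "\<phi> \<Rightarrow>\<^sub>B\<^sub>V\<^sub>A \<phi>' \<longleftrightarrow>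
     is_formula \<phi> \<and> is_formula \<phi>' \<and>
     (\<exists>\<C> \<D> y.
        (\<forall>C\<in>\<C>. is_clause C \<and> C \<noteq> {}) \<and>
        (\<forall>D\<in>\<D>. is_clause D \<and> D \<noteq> {}) \<and>
        \<C> \<bowtie> \<D> \<subseteq> \<phi> \<and>
        y \<notin> Var \<phi> \<and>
        \<phi>' = (\<phi> - (\<C> \<bowtie> \<D>)) \<union> {C \<union> {Pos y} | C. C \<in> \<C>} \<union> {{Neg y} \<union> D | D. D \<in> \<D>})"

abbreviation BVA :: "'v formula \<Rightarrow> 'v formula \<Rightarrow> bool" (infix "\<Rightarrow>\<^sup>*\<^sub>B\<^sub>V\<^sub>A" 50) where
  "\<phi> \<Rightarrow>\<^sup>*\<^sub>B\<^sub>V\<^sub>A \<phi>' \<equiv> BVA_step\<^sup>*\<^sup>* \<phi> \<phi>'"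

end

theory Submission
  imports Defs "HOL-Real_Asymp.Real_Asymp"
begin

text \<open>
  View a 2-CNF formula as a graph on its N = 2n literals, in which one BVA step replaces a biclique
  A x B by two stars, centred at y and at its negation. Order the literals, orient every edge
  upwards and cut the upper endpoints into groups of k consecutive literals. Two rounds of steps,
  in the style of Lupanov and Nechiporuk, give the bound.

  First, for each group g and each pattern P in g, factor the biclique between P and the literals u
  whose upper neighbourhood in g is exactly P. As u only meets groups reaching above it,
  about N^2 / (2k) clauses join a literal u to a pattern variable; the others are few.

  Second, cut the lower endpoints into groups of r literals, match up the neighbours of each pattern
  variable inside each group, and factor, for each pair of literals, the biclique between this pair
  and the pattern variables that matched it. This halves the dominant term to
  N^2 / (4k) = n^2 / k. With k about lg n - 3 lg lg n and r about n / (lg n)^2,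
  everything else is o(n^2 / lg n).
\<close>

section \<open>Bicliques of two-literal clauses and their replacement by two stars\<close>

definition edges :: "'a set \<Rightarrow> 'a set \<Rightarrow> 'a set set" where
  "edges A B = (\<lambda>(a, b). {a, b}) ` (A \<times> B)"

lemma edges_iff: "e \<in> edges A B \<longleftrightarrow> (\<exists>a\<in>A. \<exists>b\<in>B. e = {a, b})"
  by (auto simp: edges_def)

lemma card_edges_le:
  assumes "finite A" "finite B"
  shows "card (edges A B) \<le> card A * card B"
  unfolding edges_def using assms
  by (metis card_cartesian_product card_image_le finite_cartesian_product)

lemma finite_edges: "finite A \<Longrightarrow> finite B \<Longrightarrow> finite (edges A B)"
  by (auto simp: edges_def)

lemma two_cnf_finite_Var: "two_cnf \<phi> \<Longrightarrow> finite (Var \<phi>)"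
  by (auto simp: two_cnf_def Var_def is_formula_def is_clause_def)

lemma is_clause_pair: "lit_var a \<noteq> lit_var b \<Longrightarrow> is_clause {a, b}"
  by (auto simp: is_clause_def)

lemma two_cnf_Un: "two_cnf \<phi> \<Longrightarrow> two_cnf \<psi> \<Longrightarrow> two_cnf (\<phi> \<union> \<psi>)"
  by (auto simp: two_cnf_def is_formula_def)

lemma two_cnf_subset: "two_cnf \<phi> \<Longrightarrow> \<psi> \<subseteq> \<phi> \<Longrightarrow> two_cnf \<psi>"
  by (auto simp: two_cnf_def is_formula_def intro: finite_subset)

lemma two_cnf_edges:
  assumes "finite A" "finite B" "\<And>a b. a \<in> A \<Longrightarrow> b \<in> B \<Longrightarrow> lit_var a \<noteq> lit_var b"
  shows "two_cnf (edges A B)"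
proof -
  have "card {a, b} = 2" if "a \<in> A" "b \<in> B" for a b
    using assms(3)[OF that] by (auto simp: card_2_iff)
  then show ?thesis
    using assms by (auto simp: two_cnf_def is_formula_def finite_edges edges_iff intro!: is_clause_pair)
qed

text \<open>Taking the unit clauses over \<open>A\<close> and over \<open>B\<close> as the two
  factors makes their join equal to \<open>edges A B\<close>. The variable \<open>y\<close> must
  avoid \<open>A\<close> and \<open>B\<close> separately: if one side is empty, the other need not
  occur in \<open>\<phi>\<close>.\<close>

lemma biclique_BVA_step:
  assumes "two_cnf \<phi>" "finite A" "finite B" "edges A B \<subseteq> \<phi>"
    and y: "y \<notin> Var \<phi>" "y \<notin> lit_var ` (A \<union> B)"
  defines "\<phi>' \<equiv> (\<phi> - edges A B) \<union> edges A {Pos y} \<union> edges {Neg y} B"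
  shows "two_cnf \<phi>'" "\<phi> \<Rightarrow>\<^sub>B\<^sub>V\<^sub>A \<phi>'"
proof -
  show two: "two_cnf \<phi>'"
    unfolding \<phi>'_def using assms(1-3) y
    by (intro two_cnf_Un two_cnf_edges two_cnf_subset[OF assms(1)]) auto
  have clause: "is_clause {a}" for a :: "'a lit"
    by (auto simp: is_clause_def)
  define \<C> where "\<C> = (\<lambda>a. {a}) ` A"
  define \<D> where "\<D> = (\<lambda>b. {b}) ` B"
  have join: "\<C> \<bowtie> \<D> = edges A B"
    by (auto simp: \<C>_def \<D>_def clause_join_def edges_def image_iff)
  have C: "{C \<union> {Pos y} | C. C \<in> \<C>} = edges A {Pos y}"
    by (auto simp: \<C>_def edges_def image_iff)
  have D: "{{Neg y} \<union> D | D. D \<in> \<D>} = edges {Neg y} B"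
    by (auto simp: \<D>_def edges_def image_iff)
  show "\<phi> \<Rightarrow>\<^sub>B\<^sub>V\<^sub>A \<phi>'"
    unfolding BVA_step_def
  proof (intro conjI)
    show "\<exists>\<C> \<D> y. (\<forall>C\<in>\<C>. is_clause C \<and> C \<noteq> {}) \<and> (\<forall>D\<in>\<D>. is_clause D \<and> D \<noteq> {}) \<and>
        \<C> \<bowtie> \<D> \<subseteq> \<phi> \<and> y \<notin> Var \<phi> \<and>
        \<phi>' = (\<phi> - (\<C> \<bowtie> \<D>)) \<union> {C \<union> {Pos y} | C. C \<in> \<C>} \<union> {{Neg y} \<union> D | D. D \<in> \<D>}"
      by (rule exI[of _ \<C>], rule exI[of _ \<D>], rule exI[of _ y], unfold join C D \<phi>'_def)
        (use assms(4) y clause in \<open>auto simp: \<C>_def \<D>_def\<close>)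
  qed (use assms(1) two in \<open>auto simp: two_cnf_def\<close>)
qed

section \<open>Replacing a family of edge-disjoint bicliques\<close>

text \<open>Induction on \<open>I\<close>, one step per index. Disjointness keeps every biclique
  intact until its turn, and \<open>F\<close> separates the old variables from the fresh ones, so
  the result has a closed form independent of the order.\<close>

lemma biclique_family_BVA_fixed:
  assumes "finite I" "inj_on y I" "y ` I \<inter> F = {}" "two_cnf \<phi>" "Var \<phi> \<subseteq> F"
    and "\<And>i. i \<in> I \<Longrightarrow> finite (A i)" "\<And>i. i \<in> I \<Longrightarrow> finite (B i)"
    and "\<And>i. i \<in> I \<Longrightarrow> lit_var ` (A i \<union> B i) \<subseteq> F"
    and "\<And>i. i \<in> I \<Longrightarrow> edges (A i) (B i) \<subseteq> \<phi>"
    and "\<And>i j. i \<in> I \<Longrightarrow> j \<in> I \<Longrightarrow> i \<noteq> j \<Longrightarrow> edges (A i) (B i) \<inter> edges (A j) (B j) = {}"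
  defines "\<Phi> \<equiv> \<lambda>I. (\<phi> - (\<Union>i\<in>I. edges (A i) (B i))) \<union>
    (\<Union>i\<in>I. edges (A i) {Pos (y i)}) \<union> (\<Union>i\<in>I. edges {Neg (y i)} (B i))"
  shows "two_cnf (\<Phi> I) \<and> \<phi> \<Rightarrow>\<^sup>*\<^sub>B\<^sub>V\<^sub>A \<Phi> I"
  using assms(1-3,6-10)
proof (induction I rule: finite_induct)
  case empty
  then show ?case using assms(4) by (simp add: \<Phi>_def)
next
  case (insert i I)
  have IH: "two_cnf (\<Phi> I)" "\<phi> \<Rightarrow>\<^sup>*\<^sub>B\<^sub>V\<^sub>A \<Phi> I"
    using insert by auto
  have i: "finite (A i)" "finite (B i)" "lit_var ` (A i \<union> B i) \<subseteq> F" "edges (A i) (B i) \<subseteq> \<phi>"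
    "y i \<notin> F"
    using insert.prems by auto
  have disj: "edges (A i) (B i) \<inter> edges (A j) (B j) = {}" if "j \<in> I" for j
    using insert.prems(7)[of i j] insert.hyps that by auto
  have sub: "edges (A i) (B i) \<subseteq> \<Phi> I"
    using i(4) disj unfolding \<Phi>_def by blast
  have "Var (\<Phi> I) \<subseteq> F \<union> y ` I"
  proof
    fix x assume "x \<in> Var (\<Phi> I)"
    then obtain e l where e: "e \<in> \<Phi> I" "l \<in> e" "x = lit_var l"
      by (auto simp: Var_def)
    have "lit_var ` (A j \<union> B j) \<subseteq> F" if "j \<in> I" for j
      using insert.prems(5)[of j] that by auto
    moreover have "x \<in> F" if "e \<in> \<phi>"
      using that e assms(5) by (auto simp: Var_def)
    ultimately show "x \<in> F \<union> y ` I"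
      using e unfolding \<Phi>_def by (fastforce simp: edges_iff)
  qed
  moreover have "y i \<notin> y ` I"
    using insert.prems(1) insert.hyps by auto
  ultimately have y: "y i \<notin> Var (\<Phi> I)" using i by auto
  have yl: "y i \<notin> lit_var ` (A i \<union> B i)" using i by auto
  \<comment> \<open>Stars added earlier contain a variable outside \<open>F\<close>, so removing the
    biclique of \<open>i\<close> cannot delete any of their clauses.\<close>
  have new: "e \<notin> edges (A i) (B i)" if "e \<in> edges (A j) {Pos (y j)} \<union> edges {Neg (y j)} (B j)" "j \<in> I" for e j
  proof
    assume "e \<in> edges (A i) (B i)"
    then have "lit_var ` e \<subseteq> F" using i by (auto simp: edges_iff)
    moreover have "y j \<in> lit_var ` e" using that by (auto simp: edges_iff)
    ultimately show False using that insert.prems(2) by auto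
  qed
  have eq: "\<Phi> (insert i I) = (\<Phi> I - edges (A i) (B i)) \<union> edges (A i) {Pos (y i)} \<union> edges {Neg (y i)} (B i)"
    using new unfolding \<Phi>_def by blast
  show ?case
    using biclique_BVA_step[OF IH(1) i(1,2) sub y yl] IH(2) unfolding eq[symmetric]
    by (meson rtranclp.rtrancl_into_rtrancl)
qed

text \<open>An infinite variable type always leaves \<open>card I\<close> names outside the finite
  set \<open>F\<close>.\<close>

lemma biclique_family_BVA:
  fixes \<phi> :: "'v::infinite formula"
  assumes "finite I" "two_cnf \<phi>" "finite F" "Var \<phi> \<subseteq> F"
    and "\<And>i. i \<in> I \<Longrightarrow> finite (A i)" "\<And>i. i \<in> I \<Longrightarrow> finite (B i)"
    and "\<And>i. i \<in> I \<Longrightarrow> lit_var ` (A i \<union> B i) \<subseteq> F"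
    and "\<And>i. i \<in> I \<Longrightarrow> edges (A i) (B i) \<subseteq> \<phi>"
    and "\<And>i j. i \<in> I \<Longrightarrow> j \<in> I \<Longrightarrow> i \<noteq> j \<Longrightarrow> edges (A i) (B i) \<inter> edges (A j) (B j) = {}"
  obtains y \<phi>' where "inj_on y I" "y ` I \<inter> F = {}" "two_cnf \<phi>'" "\<phi> \<Rightarrow>\<^sup>*\<^sub>B\<^sub>V\<^sub>A \<phi>'"
    "\<phi>' = (\<phi> - (\<Union>i\<in>I. edges (A i) (B i))) \<union>
      (\<Union>i\<in>I. edges (A i) {Pos (y i)}) \<union> (\<Union>i\<in>I. edges {Neg (y i)} (B i))"
proof -
  have "infinite (UNIV - F)"
    using assms(3) infinite_UNIV by (metis Diff_infinite_finite)
  then obtain Y where Y: "Y \<subseteq> UNIV - F" "finite Y" "card Y = card I"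
    by (meson infinite_arbitrarily_large)
  then obtain y where "bij_betw y I Y"
    using assms(1) finite_same_card_bij by metis
  then have y: "inj_on y I" "y ` I \<inter> F = {}"
    using Y by (auto simp: bij_betw_def)
  show thesis
    using biclique_family_BVA_fixed[OF assms(1) y assms(2,4), of A B, OF assms(5-9)]
    by (intro that[OF y _ _ refl]) simp_all
qed

section \<open>Matching within colour classes, and the size of groups\<close>

text \<open>Greedy pairing: while more than \<open>H\<close> elements remain, the pigeonhole
  principle yields two of the same colour; they are paired and removed. The colours will be the
  groups of \<open>r\<close> literals.\<close>

lemma monochromatic_matching:
  fixes c :: "'a \<Rightarrow> nat"
  assumes "finite S" "c ` S \<subseteq> {..<H}"
  shows "\<exists>M. (\<forall>e\<in>M. e \<subseteq> S \<and> card e = 2 \<and> (\<exists>h. \<forall>a\<in>e. c a = h)) \<and>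
     (\<forall>e\<in>M. \<forall>e'\<in>M. e \<noteq> e' \<longrightarrow> e \<inter> e' = {}) \<and> finite M \<and>
     2 * card M \<le> card S \<and> card (S - \<Union>M) \<le> H"
  using assms
proof (induction "card S" arbitrary: S rule: less_induct)
  case less
  show ?case
  proof (cases "card S \<le> H")
    case True
    then show ?thesis by (intro exI[of _ "{}"]) auto
  next
    case False
    then have "\<not> inj_on c S"
      using card_inj_on_le[of c S "{..<H}"] less.prems by auto
    then obtain a b where ab: "a \<in> S" "b \<in> S" "a \<noteq> b" "c a = c b"
      by (auto simp: inj_on_def)
    define T where "T = S - {a, b}"
    have T: "card T + 2 = card S"
    proof -
      have "card (S - {a,b}) = card S - card {a,b}"
        using ab by (intro card_Diff_subset) auto
      moreover have "card {a,b} \<le> card S"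
        using ab less.prems by (intro card_mono) auto
      ultimately show ?thesis using ab by (simp add: T_def)
    qed
    have sT: "finite T" "c ` T \<subseteq> {..<H}"
      using less.prems by (auto simp: T_def)
    obtain M where M: "\<forall>e\<in>M. e \<subseteq> T \<and> card e = 2 \<and> (\<exists>h. \<forall>a\<in>e. c a = h)"
      "\<forall>e\<in>M. \<forall>e'\<in>M. e \<noteq> e' \<longrightarrow> e \<inter> e' = {}" "finite M" "2 * card M \<le> card T" "card (T - \<Union>M) \<le> H"
      using less.hyps[of T] T less.prems sT by auto
    have new: "{a, b} \<notin> M" using M(1) by (auto simp: T_def)
    have "S - \<Union>(insert {a, b} M) = T - \<Union>M"
      by (auto simp: T_def)
    moreover have "\<forall>e\<in>M. e \<inter> {a, b} = {}" "\<forall>e\<in>M. e \<subseteq> S"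
      using M(1) by (auto simp: T_def)
    moreover have "card {a, b} = 2" using ab by auto
    moreover have "2 * card (insert {a, b} M) \<le> card S"
      using M(3,4) T new by simp
    ultimately have "(\<forall>e\<in>insert {a, b} M. e \<subseteq> S \<and> card e = 2 \<and> (\<exists>h. \<forall>a\<in>e. c a = h)) \<and>
      (\<forall>e\<in>insert {a, b} M. \<forall>e'\<in>insert {a, b} M. e \<noteq> e' \<longrightarrow> e \<inter> e' = {}) \<and>
      finite (insert {a, b} M) \<and> 2 * card (insert {a, b} M) \<le> card S \<and>
      card (S - \<Union>(insert {a, b} M)) \<le> H"
      using M(1,2,3,5) ab
      by (simp only: ball_simps finite_insert) (simp add: Int_commute)
    then show ?thesis by (rule exI)
  qed
qed

lemma card_div_class_le:
  fixes f :: "'a \<Rightarrow> nat"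
  assumes "inj_on f L" "0 < k"
  shows "card {v \<in> L. f v div k = g} \<le> k"
proof -
  have "f ` {v \<in> L. f v div k = g} \<subseteq> {g * k..<g * k + k}"
    using dividend_less_div_times[OF assms(2)] by (auto simp: add.commute)
  then have "card {v \<in> L. f v div k = g} \<le> card {g * k..<g * k + k}"
    using assms(1) by (intro card_inj_on_le[of f]) (auto intro: inj_on_subset)
  then show ?thesis by simp
qed

section \<open>The two rounds of replacement, for arbitrary group sizes\<close>

text \<open>The summands bound, in this order, the clauses joining pairs to pattern variables, those
  spelling out patterns, those of unmatched literals, and those joining literals to their pairs. The
  factor 4 clears two halvings: one from the orientation of the edges, one from the
  matching.\<close>

lemma two_cnf_BVA_compress:
  fixes \<phi> :: "'v::infinite formula"
  assumes two: "two_cnf \<phi>" and k: "0 < k" and r: "0 < r"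
  defines "N \<equiv> 2 * card (Var \<phi>)"
  defines "G \<equiv> N div k + 1" and "H \<equiv> N div r + 1"
  shows "\<exists>\<phi>'. two_cnf \<phi>' \<and> \<phi> \<Rightarrow>\<^sup>*\<^sub>B\<^sub>V\<^sub>A \<phi>' \<and>
    4 * card \<phi>' \<le> k * (G * (G + 1)) + 4 * (G * 2 ^ k * k) + 4 * (G * 2 ^ k * H) + 8 * (N * r)"
proof -
  define V where "V = Var \<phi>"
  have finV: "finite V" using two by (simp add: V_def two_cnf_finite_Var)
  define L where "L = Pos ` V \<union> Neg ` V"
  have finL: "finite L" using finV by (simp add: L_def)
  have cardL: "card L = N"
    using finV unfolding L_def N_def V_def[symmetric]
    by (subst card_Un_disjoint) (auto simp: card_image inj_on_def)
  have L_iff: "l \<in> L \<longleftrightarrow> lit_var l \<in> V" for l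
    by (cases l) (auto simp: L_def)
  have in_L: "e \<subseteq> L" if "e \<in> \<phi>" for e
    using that unfolding subset_iff L_iff V_def Var_def by blast
  obtain f where "bij_betw f L {0..<card L}"
    using ex_bij_betw_finite_nat[OF finL] by blast
  then have inj: "inj_on f L" and f_less: "\<And>l. l \<in> L \<Longrightarrow> f l < N"
    by (auto simp: bij_betw_def cardL)

  \<comment> \<open>Only neighbours above \<open>u\<close> count, so each clause is charged to its
    lower endpoint alone.\<close>
  define pat where "pat u g = {v \<in> L. f v div k = g \<and> f u < f v \<and> {u, v} \<in> \<phi>}" for u g
  \<comment> \<open>The empty pattern is left out: it covers no clause, and a literal above group
    \<open>g\<close> could have it, which would spoil the triangular count in
    \<open>sumA\<close>.\<close>
  define I where "I = (SIGMA g:{..<G}. Pow {v \<in> L. f v div k = g} - {{}})"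
  \<comment> \<open>Equality with \<open>P\<close>, rather than inclusion, puts each literal into at
    most one \<open>A (g, P)\<close> for a given \<open>g\<close>.\<close>
  define A where "A = (\<lambda>(g, P). {u \<in> L. pat u g = P})"
  define B where "B = (\<lambda>(g :: nat, P :: 'v lit set). P)"
  have finI: "finite I" using finL by (auto simp: I_def)
  have A_sub: "A i \<subseteq> L" for i by (auto simp: A_def split: prod.splits)
  have finA: "finite (A i)" for i using finL A_sub finite_subset by blast
  have B_sub: "B i \<subseteq> L" if "i \<in> I" for i using that by (auto simp: I_def B_def)
  have finB: "finite (B i)" if "i \<in> I" for i using finL B_sub[OF that] finite_subset by blast
  \<comment> \<open>The added 1 in \<open>G\<close>, and likewise in \<open>H\<close>, accounts for
    a last incomplete group.\<close>
  have div_G: "f v div k < G" if "v \<in> L" for v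
    using f_less[OF that] unfolding G_def by (simp add: div_le_mono less_Suc_eq_le)
  have div_H: "f v div r < H" if "v \<in> L" for v
    using f_less[OF that] unfolding H_def by (simp add: div_le_mono less_Suc_eq_le)
  have AB: "{a, b} \<in> \<phi> \<and> f a < f b \<and> f b div k = fst i \<and> pat a (fst i) = snd i"
    if "a \<in> A i" "b \<in> B i" for a b i
    using that by (cases i) (auto simp: A_def B_def pat_def)
  have edges_sub: "edges (A i) (B i) \<subseteq> \<phi>" for i
    using AB unfolding subset_iff edges_iff by metis
  \<comment> \<open>The order recovers the lower and upper endpoint of a clause; the upper one gives
    the group, and the lower one then gives the pattern.\<close>
  have edges_disj: "edges (A i) (B i) \<inter> edges (A j) (B j) = {}" if "i \<noteq> j" for i j
  proof (rule ccontr)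
    assume "edges (A i) (B i) \<inter> edges (A j) (B j) \<noteq> {}"
    then obtain a b a' b' where *: "a \<in> A i" "b \<in> B i" "a' \<in> A j" "b' \<in> B j" "{a, b} = {a', b'}"
      by (auto simp: edges_iff) (metis insert_commute)
    then have "a = a' \<and> b = b'"
      using AB[of a i b] AB[of a' j b'] by (auto simp: doubleton_eq_iff)
    then show False
      using AB[of a i b] AB[of a' j b'] * that by (simp add: prod_eq_iff)
  qed
  \<comment> \<open>No clause of \<open>\<phi>\<close> survives the first round, so
    \<open>\<phi>1\<close> consists of stars only.\<close>
  have covered: "\<phi> \<subseteq> (\<Union>i\<in>I. edges (A i) (B i))"
  proof
    fix e assume e: "e \<in> \<phi>"
    then have "card e = 2" using two by (auto simp: two_cnf_def)
    then obtain a b where ab: "e = {a, b}" "a \<noteq> b" by (auto simp: card_2_iff)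
    have "a \<in> L" "b \<in> L" using in_L[OF e] ab by auto
    then have "f a \<noteq> f b" using inj ab by (auto simp: inj_on_def)
    have *: "{u, v} \<in> (\<Union>i\<in>I. edges (A i) (B i))" if "f u < f v" "{u, v} \<in> \<phi>" for u v
    proof -
      have uv: "u \<in> L" "v \<in> L" using in_L[OF that(2)] by auto
      define i where "i = (f v div k, pat u (f v div k))"
      have v: "v \<in> pat u (f v div k)" using uv that by (auto simp: pat_def)
      have "i \<in> I" using div_G[OF uv(2)] v by (auto simp: I_def i_def pat_def)
      moreover have "u \<in> A i" "v \<in> B i" using uv v by (auto simp: A_def B_def i_def)
      ultimately show ?thesis by (auto simp: edges_iff)
    qed
    show "e \<in> (\<Union>i\<in>I. edges (A i) (B i))"
    proof (cases "f a < f b")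
      case True then show ?thesis using *[of a b] e ab by simp
    next
      case False
      then show ?thesis using *[of b a] e ab \<open>f a \<noteq> f b\<close> by (simp add: insert_commute)
    qed
  qed
  have lit_sub: "lit_var ` (A i \<union> B i) \<subseteq> V" if "i \<in> I" for i
    using A_sub B_sub[OF that] L_iff by blast
  obtain y \<phi>1 where y: "inj_on y I" "y ` I \<inter> V = {}" and \<phi>1: "two_cnf \<phi>1" "\<phi> \<Rightarrow>\<^sup>*\<^sub>B\<^sub>V\<^sub>A \<phi>1"
    and "\<phi>1 = (\<phi> - (\<Union>i\<in>I. edges (A i) (B i))) \<union>
      (\<Union>i\<in>I. edges (A i) {Pos (y i)}) \<union> (\<Union>i\<in>I. edges {Neg (y i)} (B i))"
    using biclique_family_BVA[OF finI two finV, of A B] finA finB lit_sub edges_sub edges_disj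
    by (auto simp: V_def)
  then have \<phi>1_eq: "\<phi>1 = (\<Union>i\<in>I. edges (A i) {Pos (y i)}) \<union> (\<Union>i\<in>I. edges {Neg (y i)} (B i))"
    using covered by auto

  define matching where "matching i M \<longleftrightarrow>
     (\<forall>e\<in>M. e \<subseteq> A i \<and> card e = 2 \<and> (\<exists>h. \<forall>a\<in>e. f a div r = h)) \<and>
     (\<forall>e\<in>M. \<forall>e'\<in>M. e \<noteq> e' \<longrightarrow> e \<inter> e' = {}) \<and> finite M \<and>
     2 * card M \<le> card (A i) \<and> card (A i - \<Union>M) \<le> H" for i M
  have "\<exists>M. matching i M" for i
    unfolding matching_def using finA A_sub div_H by (intro monochromatic_matching) blast+
  then obtain M where matching: "\<And>i. matching i (M i)"
    by metis
  have M: "e \<subseteq> A i" "card e = 2" "\<And>a b. a \<in> e \<Longrightarrow> b \<in> e \<Longrightarrow> f a div r = f b div r"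
    "\<And>e'. e' \<in> M i \<Longrightarrow> e \<noteq> e' \<Longrightarrow> e \<inter> e' = {}" if "e \<in> M i" for i e
    using matching[of i] that unfolding matching_def by (blast, blast, metis, blast)
  have card_M: "finite (M i)" "2 * card (M i) \<le> card (A i)" "card (A i - \<Union>(M i)) \<le> H" for i
    using matching[of i] by (auto simp: matching_def)
  \<comment> \<open>The same pair may be matched in many \<open>A i\<close>. Collecting all pattern
    variables that use it in \<open>D e\<close> means that its two literals are joined to the new
    variable only once.\<close>
  define J where "J = (\<Union>i\<in>I. M i)"
  define D where "D e = (Pos \<circ> y) ` {i \<in> I. e \<in> M i}" for e
  have finJ: "finite J" using finI card_M(1) by (auto simp: J_def)
  have J_L: "e \<subseteq> L" if "e \<in> J" for e using that M(1) A_sub by (fastforce simp: J_def)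
  have J_card: "card e = 2" if "e \<in> J" for e using that M(2) by (auto simp: J_def)
  have finD: "finite (D e)" for e using finI by (auto simp: D_def)
  have D_edges: "edges e (D e) \<subseteq> \<phi>1" for e
    using M(1) unfolding \<phi>1_eq D_def by (fastforce simp: edges_iff)
  have Pos_y: "Pos (y i) \<notin> L" if "i \<in> I" for i using y(2) that by (auto simp: L_iff)
  \<comment> \<open>Since \<open>Pos (y i)\<close> lies outside \<open>L\<close>, a common clause
    determines both its literal and \<open>i\<close>; two pairs of \<open>M i\<close> sharing that
    literal must coincide.\<close>
  have D_disj: "edges e (D e) \<inter> edges e' (D e') = {}" if "e \<in> J" "e' \<in> J" "e \<noteq> e'" for e e'
  proof (rule ccontr)
    assume "edges e (D e) \<inter> edges e' (D e') \<noteq> {}"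
    then obtain a i a' i' where *: "a \<in> e" "a' \<in> e'" "i \<in> I" "i' \<in> I" "e \<in> M i" "e' \<in> M i'"
      "{a, Pos (y i)} = {a', Pos (y i')}"
      by (auto simp: edges_iff D_def) metis
    have "a \<in> L" "a' \<in> L" using * J_L that by auto
    then have "a = a'" "y i = y i'" using *(7) Pos_y[OF *(3)] Pos_y[OF *(4)] by (auto simp: doubleton_eq_iff)
    then have "i = i'" using y(1) * by (auto simp: inj_on_def)
    then show False using M(4)[of e i e'] * \<open>a = a'\<close> that by auto
  qed
  define F where "F = Var \<phi>1 \<union> V \<union> y ` I"
  have finF: "finite F" using finI finV two_cnf_finite_Var[OF \<phi>1(1)] by (auto simp: F_def)
  have D_F: "lit_var ` (e \<union> D e) \<subseteq> F" if "e \<in> J" for e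
    using J_L[OF that] by (auto simp: F_def D_def L_iff)
  have finJe: "finite e" if "e \<in> J" for e using J_L[OF that] finL finite_subset by blast
  have V1: "Var \<phi>1 \<subseteq> F" by (auto simp: F_def)
  obtain z \<phi>2 where "inj_on z J" "z ` J \<inter> F = {}" and \<phi>2: "two_cnf \<phi>2" "\<phi>1 \<Rightarrow>\<^sup>*\<^sub>B\<^sub>V\<^sub>A \<phi>2"
    and \<phi>2_eq: "\<phi>2 = (\<phi>1 - (\<Union>e\<in>J. edges e (D e))) \<union>
      (\<Union>e\<in>J. edges e {Pos (z e)}) \<union> (\<Union>e\<in>J. edges {Neg (z e)} (D e))"
    by (rule biclique_family_BVA[OF finJ \<phi>1(1) finF V1, of "\<lambda>e. e" D,
          OF finJe finD D_F D_edges D_disj])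

  \<comment> \<open>Of the summands, \<open>S4\<close> dominates: it holds one clause per matched pair.\<close>
  define S1 where "S1 = (\<Union>i\<in>I. edges {Neg (y i)} (B i))"
  define S2 where "S2 = (\<Union>i\<in>I. edges (A i - \<Union>(M i)) {Pos (y i)})"
  define S3 where "S3 = (\<Union>e\<in>J. edges e {Pos (z e)})"
  define S4 where "S4 = (\<Union>e\<in>J. edges {Neg (z e)} (D e))"
  \<comment> \<open>A clause joining a matched literal to \<open>Pos (y i)\<close> belongs to some
    \<open>edges e (D e)\<close> and is removed, so only the unmatched literals contribute to
    \<open>S2\<close>.\<close>
  have \<phi>2_sub: "\<phi>2 \<subseteq> S1 \<union> S2 \<union> S3 \<union> S4"
  proof -
    have "edges (A i) {Pos (y i)} \<subseteq> S2 \<union> (\<Union>e\<in>J. edges e (D e))" if "i \<in> I" for i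
    proof
      fix c assume "c \<in> edges (A i) {Pos (y i)}"
      then obtain a where a: "a \<in> A i" "c = {a, Pos (y i)}" by (auto simp: edges_iff)
      show "c \<in> S2 \<union> (\<Union>e\<in>J. edges e (D e))"
      proof (cases "a \<in> \<Union>(M i)")
        case True
        then obtain e where "e \<in> M i" "a \<in> e" by blast
        moreover from this have "e \<in> J" "Pos (y i) \<in> D e"
          using that unfolding J_def D_def by (blast, simp)
        ultimately have "e \<in> J" "c \<in> edges e (D e)"
          using a by (auto simp: edges_iff)
        then show ?thesis by blast
      next
        case False
        then have "c \<in> edges (A i - \<Union>(M i)) {Pos (y i)}" using a by (auto simp: edges_iff)
        then show ?thesis using that by (auto simp: S2_def)
      qed
    qed
    then show ?thesis unfolding \<phi>2_eq \<phi>1_eq S1_def S3_def S4_def by blast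
  qed

  have class_k: "card {v \<in> L. f v div k = g} \<le> k" for g by (rule card_div_class_le[OF inj k])
  have class_r: "card {v \<in> L. f v div r = g} \<le> r" for g by (rule card_div_class_le[OF inj r])
  have cardI: "card I \<le> G * 2 ^ k"
  proof -
    have "card (Pow {v \<in> L. f v div k = g} - {{}}) \<le> 2 ^ k" for g
    proof -
      have "card (Pow {v \<in> L. f v div k = g} - {{}}) \<le> card (Pow {v \<in> L. f v div k = g})"
        using finL by (intro card_mono) auto
      also have "\<dots> \<le> 2 ^ k" using class_k finL by (simp add: card_Pow)
      finally show ?thesis .
    qed
    then have "(\<Sum>g<G. card (Pow {v \<in> L. f v div k = g} - {{}})) \<le> (\<Sum>g<G. 2 ^ k)"
      by (intro sum_mono)
    then show ?thesis using finL by (simp add: I_def)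
  qed
  have cardB: "card (B i) \<le> k" if "i \<in> I" for i
  proof -
    have "B i \<subseteq> {v \<in> L. f v div k = fst i}" using that by (auto simp: I_def B_def)
    then have "card (B i) \<le> card {v \<in> L. f v div k = fst i}"
      using finL by (intro card_mono) auto
    then show ?thesis using class_k le_trans by blast
  qed
  have S1: "card S1 \<le> G * 2 ^ k * k"
  proof -
    have "card S1 \<le> (\<Sum>i\<in>I. card (edges {Neg (y i)} (B i)))"
      unfolding S1_def by (rule card_UN_le[OF finI])
    also have "\<dots> \<le> (\<Sum>i\<in>I. k)"
    proof (rule sum_mono)
      fix i assume "i \<in> I"
      then show "card (edges {Neg (y i)} (B i)) \<le> k"
        using card_edges_le[of "{Neg (y i)}" "B i"] finB[of i] cardB[of i] by simp
    qed
    also have "\<dots> \<le> G * 2 ^ k * k" using cardI by simp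
    finally show ?thesis .
  qed
  have S2: "card S2 \<le> G * 2 ^ k * H"
  proof -
    have "card S2 \<le> (\<Sum>i\<in>I. card (edges (A i - \<Union>(M i)) {Pos (y i)}))"
      unfolding S2_def by (rule card_UN_le[OF finI])
    also have "\<dots> \<le> (\<Sum>i\<in>I. H)"
    proof (rule sum_mono)
      fix i assume "i \<in> I"
      then show "card (edges (A i - \<Union>(M i)) {Pos (y i)}) \<le> H"
        using card_edges_le[of "A i - \<Union>(M i)" "{Pos (y i)}"] finA[of i] card_M(3)[of i] by simp
    qed
    also have "\<dots> \<le> G * 2 ^ k * H" using cardI by simp
    finally show ?thesis .
  qed
  have S3: "card S3 \<le> 2 * (N * r)"
  proof -
    \<comment> \<open>A pair stays inside one group of \<open>r\<close>. Counting ordered pairs is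
      wasteful, but this term is of lower order.\<close>
    have "J \<subseteq> (\<lambda>(a, b). {a, b}) ` (SIGMA a:L. {v \<in> L. f v div r = f a div r})"
    proof
      fix e assume e: "e \<in> J"
      then obtain i where i: "e \<in> M i" by (auto simp: J_def)
      obtain a b where ab: "e = {a, b}" using J_card[OF e] by (auto simp: card_2_iff)
      have "a \<in> L" "b \<in> L" "f b div r = f a div r"
        using J_L[OF e] M(3)[OF i, of b a] ab by auto
      then show "e \<in> (\<lambda>(a, b). {a, b}) ` (SIGMA a:L. {v \<in> L. f v div r = f a div r})"
        using ab by (auto simp: image_iff)
    qed
    then have "card J \<le> card (SIGMA a:L. {v \<in> L. f v div r = f a div r})"
      using finL by (intro surj_card_le) auto
    also have "\<dots> = (\<Sum>a\<in>L. card {v \<in> L. f v div r = f a div r})" using finL by simp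
    also have "\<dots> \<le> (\<Sum>a\<in>L. r)" by (intro sum_mono class_r)
    also have "\<dots> = N * r" by (simp add: cardL)
    finally have cardJ: "card J \<le> N * r" .
    have "card S3 \<le> (\<Sum>e\<in>J. card (edges e {Pos (z e)}))"
      unfolding S3_def by (rule card_UN_le[OF finJ])
    also have "\<dots> \<le> (\<Sum>e\<in>J. 2)"
    proof (rule sum_mono)
      fix e assume "e \<in> J"
      then show "card (edges e {Pos (z e)}) \<le> 2"
        using card_edges_le[of e "{Pos (z e)}"] finJe[of e] J_card[of e] by simp
    qed
    also have "\<dots> \<le> 2 * (N * r)" using cardJ by simp
    finally show ?thesis .
  qed
  \<comment> \<open>First halving: a non-empty pattern has a member of group \<open>g\<close> above
    \<open>u\<close>, so \<open>u\<close> has a position below \<open>(g + 1) * k\<close>, and the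
    sum over \<open>g\<close> is triangular.\<close>
  have sumA: "2 * (\<Sum>i\<in>I. card (A i)) \<le> k * (G * (G + 1))"
  proof -
    let ?T = "SIGMA g:{..<G}. {u \<in> L. f u < (g + 1) * k}"
    have "(\<Sum>i\<in>I. card (A i)) = card (SIGMA i:I. A i)" using finI finA by simp
    also have "\<dots> \<le> card ?T"
    proof (rule card_inj_on_le[of "\<lambda>(i, u). (fst i, u)"])
      show "inj_on (\<lambda>(i, u). (fst i, u)) (SIGMA i:I. A i)"
        by (auto simp: inj_on_def A_def)
      show "(\<lambda>(i, u). (fst i, u)) ` (SIGMA i:I. A i) \<subseteq> ?T"
      proof (clarsimp, intro conjI)
        fix g P u assume i: "(g, P) \<in> I" and u: "u \<in> A (g, P)"
        show "g < G" using i by (auto simp: I_def)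
        show "u \<in> L" using u A_sub by blast
        obtain v where "v \<in> P" using i by (auto simp: I_def)
        then have v: "f u < f v" "f v div k = g" using u by (auto simp: A_def pat_def)
        then have "f v < (g + 1) * k"
          using dividend_less_div_times[OF k, of "f v"] by (simp add: algebra_simps)
        then show "f u < k + g * k" using v by (simp add: algebra_simps)
      qed
      show "finite ?T" using finL by auto
    qed
    also have "\<dots> = (\<Sum>g<G. card {u \<in> L. f u < (g + 1) * k})" using finL by simp
    also have "\<dots> \<le> (\<Sum>g<G. (g + 1) * k)"
    proof (rule sum_mono)
      fix g
      have "card {u \<in> L. f u < (g + 1) * k} \<le> card {..<(g + 1) * k}"
        by (rule card_inj_on_le[of f]) (auto intro: inj_on_subset[OF inj])
      then show "card {u \<in> L. f u < (g + 1) * k} \<le> (g + 1) * k" by simp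
    qed
    finally have "2 * (\<Sum>i\<in>I. card (A i)) \<le> 2 * (\<Sum>g<G. (g + 1) * k)" by simp
    moreover have "2 * (\<Sum>g<m. (g + 1) * k) = k * (m * (m + 1))" for m
      by (induction m) (auto simp: algebra_simps)
    ultimately show ?thesis by metis
  qed
  \<comment> \<open>Second halving: one clause for each matched pair replaces the two that joined
    its literals to \<open>y i\<close>.\<close>
  have S4: "4 * card S4 \<le> k * (G * (G + 1))"
  proof -
    have "S4 \<subseteq> (\<lambda>(i, e). {Neg (z e), Pos (y i)}) ` (SIGMA i:I. M i)"
    proof
      fix c assume "c \<in> S4"
      then obtain e i where "(i, e) \<in> (SIGMA i:I. M i)" "c = {Neg (z e), Pos (y i)}"
        by (auto simp: S4_def D_def edges_iff)
      then show "c \<in> (\<lambda>(i, e). {Neg (z e), Pos (y i)}) ` (SIGMA i:I. M i)"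
        by (intro image_eqI[of _ _ "(i, e)"]) auto
    qed
    then have "card S4 \<le> card (SIGMA i:I. M i)"
      using finI card_M(1) by (meson card_image_le card_mono finite_SigmaI finite_imageI le_trans)
    also have "\<dots> = (\<Sum>i\<in>I. card (M i))" using finI card_M(1) by simp
    finally have "4 * card S4 \<le> 2 * (\<Sum>i\<in>I. 2 * card (M i))"
      by (simp add: sum_distrib_left[symmetric])
    also have "\<dots> \<le> 2 * (\<Sum>i\<in>I. card (A i))" using card_M(2) by (intro mult_left_mono sum_mono) auto
    finally show ?thesis using sumA by linarith
  qed
  have "card \<phi>2 \<le> card (S1 \<union> S2 \<union> S3 \<union> S4)"
  proof (rule card_mono[OF _ \<phi>2_sub])
    show "finite (S1 \<union> S2 \<union> S3 \<union> S4)"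
      using finI finJ finA finB finD finJe
      by (auto simp: S1_def S2_def S3_def S4_def intro!: finite_edges)
  qed
  also have "\<dots> \<le> card S1 + card S2 + card S3 + card S4"
    by (meson card_Un_le add_mono le_refl le_trans)
  finally have "4 * card \<phi>2 \<le> k * (G * (G + 1)) + 4 * (G * 2 ^ k * k) + 4 * (G * 2 ^ k * H) + 8 * (N * r)"
    using S1 S2 S3 S4 by linarith
  then show ?thesis using \<phi>1(2) \<phi>2 by (meson rtranclp_trans)
qed

section \<open>Choice of the group sizes for large n\<close>

text \<open>The four summands are those of \<open>two_cnf_BVA_compress\<close> for \<open>k = \<lfloor>l - 3 lg l\<rfloor>\<close> and
  \<open>r = \<lceil>x / l\<^sup>2\<rceil>\<close>; \<open>\<kappa>\<close> is a lower bound for \<open>k\<close>.\<close>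
definition BVA_bound :: "nat \<Rightarrow> real" where
  "BVA_bound n = (let x = real n; l = log 2 x; \<kappa> = l - 3 * log 2 l - 1 in
     (2 * x + l) * (2 * x / \<kappa> + 2) / 4 + (2 * x + l) * (x / l ^ 3) +
     (2 * x / \<kappa> + 1) * (x / l ^ 3) * (2 * l ^ 2 + 1) + 4 * x * (x / l ^ 2 + 1))"

text \<open>Subtracting \<open>3 * log 2 l\<close> makes \<open>2 ^ k\<close> at most
  \<open>x / l ^ 3\<close>. With \<open>G\<close> about \<open>2 * x / l\<close> and
  \<open>H\<close> about \<open>2 * l ^ 2\<close>, the product \<open>G * 2 ^ k * H\<close> is then
  of order \<open>x ^ 2 / l ^ 2\<close>, as is \<open>N * r\<close>.\<close>

lemma two_cnf_BVA_bound:
  fixes \<phi> :: "'v::infinite formula"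
  assumes two: "two_cnf \<phi>" and n: "card (Var \<phi>) = n"
    and l: "1 \<le> log 2 (real n)" and \<kappa>: "0 < log 2 (real n) - 3 * log 2 (log 2 (real n)) - 1"
  shows "\<exists>\<phi>'. two_cnf \<phi>' \<and> \<phi> \<Rightarrow>\<^sup>*\<^sub>B\<^sub>V\<^sub>A \<phi>' \<and> real (card \<phi>') \<le> BVA_bound n"
proof -
  define x where "x = real n"
  define l where "l = log 2 x"
  define \<kappa> where "\<kappa> = l - 3 * log 2 l - 1"
  define k where "k = nat \<lfloor>l - 3 * log 2 l\<rfloor>"
  define r where "r = nat \<lceil>x / l ^ 2\<rceil>"
  define N where "N = 2 * card (Var \<phi>)"
  define G where "G = N div k + 1"
  define H where "H = N div r + 1"
  have l1: "1 \<le> l" and \<kappa>0: "0 < \<kappa>"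
    using l \<kappa> by (auto simp: l_def x_def \<kappa>_def)
  \<comment> \<open>As \<open>log 2 0\<close> has the value 0, the hypothesis on the logarithm
    excludes \<open>n = 0\<close>.\<close>
  have x0: "0 < x" using l by (cases "n = 0") (auto simp: x_def log_def)
  have log0: "0 \<le> log 2 l" using l1 by simp
  \<comment> \<open>Rounding down loses less than 1, whence the final \<open>- 1\<close> in
    \<open>\<kappa>\<close>.\<close>
  have k_ge: "\<kappa> \<le> k" and k_le': "k \<le> l - 3 * log 2 l"
    using \<kappa>0 unfolding k_def \<kappa>_def by linarith+
  have k_le: "k \<le> l" using k_le' log0 by linarith
  have k0: "0 < k" using k_ge \<kappa>0 by (cases "k = 0") auto
  have "2 ^ k = 2 powr real k" by (simp add: powr_realpow)
  also have "\<dots> \<le> 2 powr (l - 3 * log 2 l)" using k_le' by simp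
  also have "\<dots> = x / l ^ 3"
  proof -
    have "2 powr (3 * log 2 l) = (2 powr log 2 l) ^ 3"
      by (simp add: powr_power mult.commute)
    then show ?thesis using x0 l1 by (simp add: powr_diff l_def)
  qed
  finally have pow_k: "2 ^ k \<le> x / l ^ 3" .
  have xl: "0 < x / l ^ 2" using x0 l1 by simp
  have r_ge: "x / l ^ 2 \<le> r" and r_le: "r \<le> x / l ^ 2 + 1"
    using xl unfolding r_def by linarith+
  have r0: "0 < r" using r_ge xl by (cases "r = 0") auto
  have N: "real N = 2 * x" by (simp add: N_def n x_def)
  have "real (N div k) \<le> 2 * x / k" using of_nat_div_le_of_nat[where 'a=real, of N k] N by simp
  then have G_le: "real G \<le> 2 * x / k + 1" by (simp add: G_def)
  have "2 * x / k \<le> 2 * x / \<kappa>" using k_ge \<kappa>0 x0 by (intro divide_left_mono) auto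
  then have G_le': "real G \<le> 2 * x / \<kappa> + 1" using G_le by simp
  have kG: "k * real G \<le> 2 * x + l"
  proof -
    have "k * real G \<le> k * (2 * x / k + 1)" using G_le by (intro mult_left_mono) auto
    also have "\<dots> = 2 * x + k" using k0 by (simp add: field_simps)
    finally show ?thesis using k_le by simp
  qed
  have H_le: "real H \<le> 2 * l ^ 2 + 1"
  proof -
    have "real (N div r) \<le> 2 * x / r" using of_nat_div_le_of_nat[where 'a=real, of N r] N by simp
    also have "\<dots> \<le> 2 * x / (x / l ^ 2)" using r_ge xl x0 r0 by (intro divide_left_mono mult_pos_pos) auto
    also have "\<dots> = 2 * l ^ 2" using x0 l1 by simp
    finally show ?thesis by (simp add: H_def)
  qed
  obtain \<phi>' where \<phi>': "two_cnf \<phi>'" "\<phi> \<Rightarrow>\<^sup>*\<^sub>B\<^sub>V\<^sub>A \<phi>'" and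
    "4 * card \<phi>' \<le> k * (G * (G + 1)) + 4 * (G * 2 ^ k * k) + 4 * (G * 2 ^ k * H) + 8 * (N * r)"
    using two_cnf_BVA_compress[OF two k0 r0] unfolding G_def H_def N_def by blast
  then have "real (4 * card \<phi>') \<le>
      real (k * (G * (G + 1)) + 4 * (G * 2 ^ k * k) + 4 * (G * 2 ^ k * H) + 8 * (N * r))"
    using of_nat_mono by blast
  then have "real (card \<phi>') \<le> (k * real G) * (real G + 1) / 4 + (k * real G) * 2 ^ k +
      real G * 2 ^ k * real H + 2 * (real N * real r)"
    by (simp add: field_simps)
  also have "\<dots> \<le> (2 * x + l) * (2 * x / \<kappa> + 2) / 4 + (2 * x + l) * (x / l ^ 3) +
     (2 * x / \<kappa> + 1) * (x / l ^ 3) * (2 * l ^ 2 + 1) + 2 * (2 * x * (x / l ^ 2 + 1))"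
  proof -
    have t1: "(k * real G) * (real G + 1) \<le> (2 * x + l) * (2 * x / \<kappa> + 2)"
      using kG G_le' x0 l1 \<kappa>0 by (intro mult_mono) auto
    have t2: "(k * real G) * 2 ^ k \<le> (2 * x + l) * (x / l ^ 3)"
      using kG pow_k x0 l1 by (intro mult_mono) auto
    have t3: "real G * 2 ^ k * real H \<le> (2 * x / \<kappa> + 1) * (x / l ^ 3) * (2 * l ^ 2 + 1)"
      using G_le' pow_k H_le x0 l1 \<kappa>0 by (intro mult_mono) auto
    have t4: "real N * real r \<le> 2 * x * (x / l ^ 2 + 1)"
      unfolding N using r_le x0 by (intro mult_left_mono) auto
    show ?thesis
      by (intro add_mono divide_right_mono mult_left_mono t1 t2 t3 t4) simp_all
  qed
  also have "\<dots> = BVA_bound n"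
    by (simp add: BVA_bound_def Let_def x_def l_def \<kappa>_def)
  finally show ?thesis using \<phi>' by blast
qed

section \<open>Trivial bounds for small n\<close>

lemma two_cnf_card_le:
  assumes "two_cnf \<phi>"
  shows "card \<phi> \<le> 4 * card (Var \<phi>) ^ 2"
proof -
  let ?L = "Pos ` Var \<phi> \<union> Neg ` Var \<phi>"
  have fin: "finite (Var \<phi>)" by (rule two_cnf_finite_Var[OF assms])
  have L: "l \<in> ?L \<longleftrightarrow> lit_var l \<in> Var \<phi>" for l
    by (cases l) auto
  have "\<phi> \<subseteq> edges ?L ?L"
  proof
    fix e assume e: "e \<in> \<phi>"
    then obtain a b where ab: "e = {a, b}"
      using assms by (auto simp: two_cnf_def card_2_iff)
    then have "a \<in> ?L" "b \<in> ?L"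
      using e unfolding L by (auto simp: Var_def intro!: bexI[of _ e])
    then show "e \<in> edges ?L ?L" unfolding edges_iff using ab by blast
  qed
  then have "card \<phi> \<le> card (edges ?L ?L)"
    using fin by (intro card_mono finite_edges) auto
  also have "\<dots> \<le> card ?L * card ?L" using fin by (intro card_edges_le) auto
  also have "\<dots> \<le> (2 * card (Var \<phi>)) * (2 * card (Var \<phi>))"
  proof -
    have "card ?L \<le> 2 * card (Var \<phi>)"
      using card_Un_le[of "Pos ` Var \<phi>" "Neg ` Var \<phi>"]
        card_image_le[OF fin, of Pos] card_image_le[OF fin, of Neg] by linarith
    then show ?thesis by (intro mult_mono) auto
  qed
  finally show ?thesis by (simp add: power2_eq_square)
qed

text \<open>Two distinct literals of one variable are complementary. This excludes
  \<open>n = 1\<close>, where the logarithm vanishes and the claimed bound would be 0 through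
  division by zero.\<close>

lemma two_cnf_card_Var_neq_1:
  assumes "two_cnf \<phi>"
  shows "card (Var \<phi>) \<noteq> 1"
proof
  assume "card (Var \<phi>) = 1"
  then obtain x where x: "Var \<phi> = {x}" by (auto simp: card_1_singleton_iff)
  then obtain C where C: "C \<in> \<phi>" by (auto simp: Var_def)
  then obtain a b where ab: "C = {a, b}" "a \<noteq> b" "is_clause C"
    using assms by (auto simp: two_cnf_def is_formula_def card_2_iff)
  have "lit_var a = x" "lit_var b = x" using x C ab(1) by (auto simp: Var_def)
  then show False using ab by (cases a; cases b) (auto simp: is_clause_def)
qed

section \<open>Asymptotics and conclusion\<close>

text \<open>The first summand is asymptotic to \<open>x ^ 2 / \<kappa>\<close>, where
  \<open>\<kappa>\<close> is asymptotic to \<open>l\<close> because lg lg n is o(lg n); the other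
  three are of order at most \<open>x ^ 2 / l ^ 2\<close>.\<close>

lemma BVA_bound_asymp:
  "(\<lambda>n. BVA_bound n / (real n ^ 2 / log 2 (real n)) - 1) \<longlonglongrightarrow> 0"
  unfolding BVA_bound_def Let_def by real_asymp

theorem theorem43:
  shows "\<exists>\<epsilon> :: nat \<Rightarrow> real. \<epsilon> \<longlonglongrightarrow> 0 \<and>
    (\<forall>n. \<forall>\<phi> :: 'v::infinite formula. two_cnf \<phi> \<and> card (Var \<phi>) = n \<longrightarrow>
      (\<exists>\<phi>'. two_cnf \<phi>' \<and> \<phi> \<Rightarrow>\<^sup>*\<^sub>B\<^sub>V\<^sub>A \<phi>' \<and>
        real (card \<phi>') \<le> (1 + \<epsilon> n) * (real n ^ 2 / log 2 (real n))))"
proof -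
  define large where "large n \<longleftrightarrow> 1 \<le> log 2 (real n) \<and>
    0 < log 2 (real n) - 3 * log 2 (log 2 (real n)) - 1" for n :: nat
  define \<epsilon> where "\<epsilon> n = (if large n then BVA_bound n / (real n ^ 2 / log 2 (real n)) - 1
    else 4 * log 2 (real n))" for n  \<comment> \<open>for small \<open>n\<close> the trivial bound \<open>4 n\<^sup>2\<close>\<close>
  have "eventually (\<lambda>n. 1 \<le> log 2 (real n)) sequentially"
    "eventually (\<lambda>n. 0 < log 2 (real n) - 3 * log 2 (log 2 (real n)) - 1) sequentially"
    by real_asymp+
  then have "eventually large sequentially"
    unfolding large_def by (rule eventually_conj)
  then have "eventually (\<lambda>n. BVA_bound n / (real n ^ 2 / log 2 (real n)) - 1 = \<epsilon> n) sequentially"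
    by eventually_elim (simp add: \<epsilon>_def)
  then have lim: "\<epsilon> \<longlonglongrightarrow> 0"
    by (rule Lim_transform_eventually[OF BVA_bound_asymp])
  have "\<exists>\<phi>'. two_cnf \<phi>' \<and> \<phi> \<Rightarrow>\<^sup>*\<^sub>B\<^sub>V\<^sub>A \<phi>' \<and>
      real (card \<phi>') \<le> (1 + \<epsilon> n) * (real n ^ 2 / log 2 (real n))"
    if two: "two_cnf \<phi>" and n: "card (Var \<phi>) = n" for n and \<phi> :: "'v formula"
  proof (cases "large n")
    case True
    define q where "q = real n ^ 2 / log 2 (real n)"
    have "0 < real n" using True by (cases "n = 0") (auto simp: large_def log_def)
    moreover have "0 < log 2 (real n)" using True by (simp add: large_def)
    ultimately have "0 < q" unfolding q_def by (intro divide_pos_pos zero_less_power)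
    then have "(1 + \<epsilon> n) * q = BVA_bound n"
      using True by (simp add: \<epsilon>_def flip: q_def)
    then show ?thesis
      using two_cnf_BVA_bound[OF two n] True by (simp add: large_def q_def)
  next
    case False
    \<comment> \<open>For these n no step is made: \<open>\<phi>\<close> itself is the witness,
      since \<open>\<epsilon> n\<close> times n^2 / lg n equals 4 n^2 once n is at least 2.\<close>
    have card: "real (card \<phi>) \<le> 4 * real n ^ 2"
    proof -
      have "real (card \<phi>) \<le> real (4 * n ^ 2)"
        using two_cnf_card_le[OF two] n of_nat_mono by blast
      then show ?thesis by simp
    qed
    have "real (card \<phi>) \<le> (1 + \<epsilon> n) * (real n ^ 2 / log 2 (real n))"
    proof (cases "n = 0")
      case True
      then show ?thesis using card by simp
    next
      case n0: False
      then have "2 \<le> n" using two_cnf_card_Var_neq_1[OF two] n by linarith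
      then have "0 < log 2 (real n)" by simp
      then have "(1 + \<epsilon> n) * (real n ^ 2 / log 2 (real n)) =
          real n ^ 2 / log 2 (real n) + 4 * real n ^ 2" "0 \<le> real n ^ 2 / log 2 (real n)"
        using False by (simp_all add: \<epsilon>_def field_simps)
      then show ?thesis using card by linarith
    qed
    then show ?thesis using two by blast
  qed
  then show ?thesis using lim by blast
qed

end
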